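(* Let $G$ be a nontrivial finite group of cardinality $q$, and let $T\subseteq G$ be a nonempty set of $p\ge 1$ elements of $G$, all of order $2$ (not necessarily generating $G$). Let $\operatorname{Cay}(G,T)$ be the undirected graph with vertex set $G$ and edge set $\{\{g,tg\}: g\in G,\ t\in T\}$. The function $c$ from the edge set to $T$ that assigns to the edge $\{g,tg\}$ ($g\in G$, $t\in T$) the color $t$ defines a uniform edge coloring on $\operatorname{Cay}(G,T)$, with respect to which $\operatorname{Cay}(G,T)$ is a uniformly colored graph of type $(p,q,q/2)$ and degree $p$.
   Context: A uniform edge coloring of type $(p,q,r)$ ($p,q,r$ positive integers) with degree $s\ge 1$ on an undirected $s$-regular graph $(V,E)$ (without loops or multiple edges) with $q$ vertices is a surjective map $c:E\to S$, $|S|=p$, such that adjacent edges have different colors (the coloring is proper) and $|c^{-1}(\{k\})|=r$ for every $k\in S$. A graph with such a coloring is a uniformly colored graph of type $(p,q,r)$ and degree $s$. *)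

theory Defs
  imports "HOL-Algebra.Multiplicative_Group"
begin

text \<open>Undirected graphs without loops or multiple edges: an edge is a two-element set of vertices.\<close>

definition simple_graph :: "'v set \<Rightarrow> 'v set set \<Rightarrow> bool" where
  "simple_graph V E \<longleftrightarrow> (\<forall>e\<in>E. e \<subseteq> V \<and> card e = 2)"

definition regular_graph :: "'v set \<Rightarrow> 'v set set \<Rightarrow> nat \<Rightarrow> bool" where
  "regular_graph V E s \<longleftrightarrow> simple_graph V E \<and> (\<forall>v\<in>V. card {e\<in>E. v \<in> e} = s)"

text \<open>\<open>c\<close> is a uniform edge coloring of type \<open>(p, q, r)\<close> and degree \<open>s\<close>, with color set \<open>S\<close>, on
  the graph \<open>(V, E)\<close>; equivalently, \<open>(V, E)\<close> together with \<open>c\<close> is a uniformly colored graph of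
  this type and degree. Since \<open>p\<close>, \<open>q\<close>, \<open>r\<close> are positive, the cardinality conditions force
  \<open>S\<close>, \<open>V\<close> and the color classes to be finite. Only the values of \<open>c\<close> on \<open>E\<close> matter.\<close>

definition uniform_edge_coloring ::
  "'v set \<Rightarrow> 'v set set \<Rightarrow> 'c set \<Rightarrow> ('v set \<Rightarrow> 'c) \<Rightarrow> nat \<times> nat \<times> nat \<Rightarrow> nat \<Rightarrow> bool" where
  "uniform_edge_coloring V E S c = (\<lambda>(p, q, r) s.
     p \<ge> 1 \<and> q \<ge> 1 \<and> r \<ge> 1 \<and> s \<ge> 1 \<and>
     regular_graph V E s \<and> card V = q \<and>
     card S = p \<and> c ` E = S \<and>
     (\<forall>e\<in>E. \<forall>f\<in>E. e \<noteq> f \<and> e \<inter> f \<noteq> {} \<longrightarrow> c e \<noteq> c f) \<and>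
     (\<forall>k\<in>S. card {e\<in>E. c e = k} = r))"

definition Cay_edges :: "('a, 'b) monoid_scheme \<Rightarrow> 'a set \<Rightarrow> 'a set set" where
  "Cay_edges G T = {{g, t \<otimes>\<^bsub>G\<^esub> g} | g t. g \<in> carrier G \<and> t \<in> T}"

text \<open>The color of the edge \<open>{g, t g}\<close> is \<open>t\<close>. The description is meaningful only if \<open>t\<close> is
  determined by the edge, so any use has to establish that as well.\<close>

definition Cay_color :: "('a, 'b) monoid_scheme \<Rightarrow> 'a set \<Rightarrow> 'a set \<Rightarrow> 'a" where
  "Cay_color G T e = (THE t. t \<in> T \<and> (\<exists>g\<in>carrier G. e = {g, t \<otimes>\<^bsub>G\<^esub> g}))"

end

theory Submission
  imports Defs
begin

text \<open>For an element \<open>t\<close> of order 2, left multiplication by \<open>t\<close> is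
  an involution of the group, without fixed points since \<open>t\<close> is not the identity. The
  edges of color \<open>t\<close> are exactly its orbits \<open>{g, t \<otimes> g}\<close>, so they
  split the group into pairs (\<open>card_involution_edges\<close>): hence q is even and each color
  class has q/2 edges. The rest follows from two facts. An edge may be based at either endpoint
  (\<open>involution_edge_eq\<close>), and once the base is fixed, right cancellation recovers
  \<open>t\<close> (\<open>involution_edge_inject\<close>). So the color is well defined, and
  \<open>t\<close> \<mapsto> \<open>{v, t \<otimes> v}\<close> is a bijection from \<open>T\<close>
  to the edges at \<open>v\<close>, which gives both the degree and properness.\<close>

context group
begin

lemma ord_2D:
  assumes "t \<in> carrier G" "ord t = 2"
  shows "t \<otimes> t = \<one>" "t \<noteq> \<one>"
proof -
  show "t \<otimes> t = \<one>"
    using pow_ord_eq_1[OF assms(1)] assms by (simp add: numeral_2_eq_2)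
  show "t \<noteq> \<one>"
    using assms by auto
qed

text \<open>If \<open>h\<close> is the other endpoint \<open>t \<otimes> g\<close>, then
  \<open>t \<otimes> h = g\<close>, so the pair is only listed in the other order. This allows edges
  that meet to be rebased at a common vertex.\<close>

lemma involution_edge_eq:
  assumes "t \<in> carrier G" "t \<otimes> t = \<one>" "g \<in> carrier G" "h \<in> {g, t \<otimes> g}"
  shows "{g, t \<otimes> g} = {h, t \<otimes> h}"
proof (cases "h = g")
  case False
  then have "t \<otimes> h = g"
    using assms by (simp flip: m_assoc)
  then show ?thesis
    using assms(4) False by auto
qed simp

text \<open>Rebasing the first edge at \<open>h\<close> leaves two pairs sharing the entry
  \<open>h\<close>; their other entries agree, and \<open>h\<close> cancels on the right. This is
  what makes the color of an edge unambiguous.\<close>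

lemma involution_edge_inject:
  assumes "t \<in> carrier G" "t \<otimes> t = \<one>" "u \<in> carrier G" "g \<in> carrier G" "h \<in> carrier G"
    and "{g, t \<otimes> g} = {h, u \<otimes> h}"
  shows "t = u"
proof -
  have "{h, t \<otimes> h} = {h, u \<otimes> h}"
    using involution_edge_eq[of t g h] assms by auto
  then have "t \<otimes> h = u \<otimes> h"
    by (auto simp: doubleton_eq_iff)
  then show ?thesis
    using assms by simp
qed

lemma card_involution_edge:
  assumes "t \<in> carrier G" "t \<noteq> \<one>" "g \<in> carrier G"
  shows "card {g, t \<otimes> g} = 2"
proof -
  have "t \<otimes> g \<noteq> g"
    using assms r_cancel_one by blast
  then show ?thesis
    by simp
qed

lemma card_involution_edges:
  assumes "finite (carrier G)" "t \<in> carrier G" "t \<otimes> t = \<one>" "t \<noteq> \<one>"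
  shows "2 * card ((\<lambda>g. {g, t \<otimes> g}) ` carrier G) = order G"
proof -
  let ?C = "(\<lambda>g. {g, t \<otimes> g}) ` carrier G"
  have un: "\<Union>?C = carrier G"
    using assms by auto
  \<comment> \<open>The orbits are blocks of size 2; two that share a vertex \<open>h\<close> both
    equal \<open>{h, t \<otimes> h}\<close>, so distinct ones are disjoint.\<close>
  have "2 * card ?C = card (\<Union>?C)"
  proof (rule card_partition)
    show "finite ?C" "finite (\<Union>?C)"
      using assms(1) un by auto
    show "card e = 2" if "e \<in> ?C" for e
      using that assms card_involution_edge by auto
    show "e \<inter> f = {}" if "e \<in> ?C" "f \<in> ?C" "e \<noteq> f" for e f
    proof (rule ccontr)
      assume "e \<inter> f \<noteq> {}"
      then obtain h where "h \<in> e" "h \<in> f"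
        by auto
      then have "e = {h, t \<otimes> h}" "f = {h, t \<otimes> h}"
        using that involution_edge_eq[OF assms(2,3)] by blast+
      then show False
        using \<open>e \<noteq> f\<close> by simp
    qed
  qed
  then show ?thesis
    by (simp add: un order_def)
qed

text \<open>Justifies the definite description in \<open>Cay_color\<close>: uniqueness is
  \<open>involution_edge_inject\<close>. Later facts about colors rest on this evaluation.\<close>

lemma Cay_color_edge:
  assumes "T \<subseteq> carrier G" "\<And>t. t \<in> T \<Longrightarrow> t \<otimes> t = \<one>" "g \<in> carrier G" "t \<in> T"
  shows "Cay_color G T {g, t \<otimes> g} = t"
  unfolding Cay_color_def
proof (rule the_equality)
  show "u = t" if "u \<in> T \<and> (\<exists>h\<in>carrier G. {g, t \<otimes> g} = {h, u \<otimes> h})" for u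
    using that assms involution_edge_inject[of t u g] by (elim conjE bexE) (rule sym, blast)
qed (use assms in auto)

text \<open>Every edge through \<open>v\<close> can be rebased at \<open>v\<close>. Both the degree
  count and properness are read off from this description.\<close>

lemma Cay_edges_at:
  assumes "T \<subseteq> carrier G" "\<And>t. t \<in> T \<Longrightarrow> t \<otimes> t = \<one>" "v \<in> carrier G"
  shows "{e \<in> Cay_edges G T. v \<in> e} = (\<lambda>t. {v, t \<otimes> v}) ` T"
proof (intro equalityI subsetI)
  fix e assume "e \<in> {e \<in> Cay_edges G T. v \<in> e}"
  then obtain g t where "g \<in> carrier G" "t \<in> T" "e = {g, t \<otimes> g}" "v \<in> {g, t \<otimes> g}"
    by (auto simp: Cay_edges_def)
  then have "e = {v, t \<otimes> v}"
    using involution_edge_eq[of t g v] assms by auto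
  then show "e \<in> (\<lambda>t. {v, t \<otimes> v}) ` T"
    using \<open>t \<in> T\<close> by simp
qed (use assms in \<open>auto simp: Cay_edges_def\<close>)

lemma regular_graph_Cay:
  assumes T: "T \<subseteq> carrier G" "\<And>t. t \<in> T \<Longrightarrow> t \<otimes> t = \<one>" and "\<one> \<notin> T"
  shows "regular_graph (carrier G) (Cay_edges G T) (card T)"
  unfolding regular_graph_def
proof (intro conjI ballI)
  show "simple_graph (carrier G) (Cay_edges G T)"
    unfolding simple_graph_def
  proof
    fix e assume "e \<in> Cay_edges G T"
    then obtain g t where e: "g \<in> carrier G" "t \<in> T" "e = {g, t \<otimes> g}"
      by (auto simp: Cay_edges_def)
    with assms have "t \<in> carrier G" "t \<noteq> \<one>"
      by auto
    with e show "e \<subseteq> carrier G \<and> card e = 2"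
      using card_involution_edge by auto
  qed
  fix v assume v: "v \<in> carrier G"
  \<comment> \<open>Distinct elements of \<open>T\<close> give distinct edges at \<open>v\<close>,
    so the degree is the full \<open>card T\<close>.\<close>
  have "inj_on (\<lambda>t. {v, t \<otimes> v}) T"
  proof (rule inj_onI)
    show "t = u" if "t \<in> T" "u \<in> T" "{v, t \<otimes> v} = {v, u \<otimes> v}" for t u
      using that T v involution_edge_inject[of t u v v] by auto
  qed
  then show "card {e \<in> Cay_edges G T. v \<in> e} = card T"
    by (simp add: Cay_edges_at[OF T v] card_image)
qed

lemma Cay_color_class:
  assumes T: "T \<subseteq> carrier G" "\<And>t. t \<in> T \<Longrightarrow> t \<otimes> t = \<one>" and "t \<in> T"
  shows "{e \<in> Cay_edges G T. Cay_color G T e = t} = (\<lambda>g. {g, t \<otimes> g}) ` carrier G"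
  using assms(3) Cay_color_edge[OF T] by (auto simp: Cay_edges_def)

lemma Cay_color_image:
  assumes T: "T \<subseteq> carrier G" "\<And>t. t \<in> T \<Longrightarrow> t \<otimes> t = \<one>"
  shows "Cay_color G T ` Cay_edges G T = T"
proof (intro equalityI subsetI)
  fix t assume "t \<in> T"
  \<comment> \<open>The edge of color \<open>t\<close> at the identity witnesses
    surjectivity.\<close>
  then have "Cay_color G T {\<one>, t \<otimes> \<one>} = t" "{\<one>, t \<otimes> \<one>} \<in> Cay_edges G T"
    using Cay_color_edge[OF T] by (auto simp: Cay_edges_def)
  then show "t \<in> Cay_color G T ` Cay_edges G T"
    by (metis image_eqI)
qed (use Cay_color_edge[OF T] in \<open>auto simp: Cay_edges_def\<close>)

text \<open>Based at the common vertex \<open>h\<close>, each edge is determined by its color, so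
  equal colors would force equal edges.\<close>

lemma Cay_color_proper:
  assumes T: "T \<subseteq> carrier G" "\<And>t. t \<in> T \<Longrightarrow> t \<otimes> t = \<one>"
    and "e \<in> Cay_edges G T" "f \<in> Cay_edges G T" "e \<noteq> f" "h \<in> e" "h \<in> f"
  shows "Cay_color G T e \<noteq> Cay_color G T f"
proof -
  have h: "h \<in> carrier G"
    using assms by (auto simp: Cay_edges_def)
  have "e \<in> (\<lambda>t. {h, t \<otimes> h}) ` T" "f \<in> (\<lambda>t. {h, t \<otimes> h}) ` T"
    using assms(3,4,6,7) Cay_edges_at[OF T h] by blast+
  then obtain t u where "t \<in> T" "e = {h, t \<otimes> h}" "u \<in> T" "f = {h, u \<otimes> h}"
    by auto
  then show ?thesis
    using \<open>e \<noteq> f\<close> Cay_color_edge[OF T h] by auto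
qed

end

theorem proposition5p3:
  fixes G :: "('a, 'b) monoid_scheme" (structure)
    and T :: "'a set" and p q :: nat
  assumes "group G"
    and "finite (carrier G)"
    and "carrier G \<noteq> {\<one>}"
    and "order G = q"
    and "T \<subseteq> carrier G"
    and "T \<noteq> {}"
    and "card T = p"
    and "p \<ge> 1"
    and "\<forall>t\<in>T. group.ord G t = 2"
  shows "(\<forall>g\<in>carrier G. \<forall>t\<in>T. Cay_color G T {g, t \<otimes> g} = t) \<and>
    even q \<and>
    uniform_edge_coloring (carrier G) (Cay_edges G T) T (Cay_color G T) (p, q, q div 2) p"
proof -
  interpret group G by fact
  have invol: "t \<otimes> t = \<one>" "t \<noteq> \<one>" if "t \<in> T" for t
    using that ord_2D[of t] assms(5,9) by auto
  note T = assms(5) invol(1)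
  have color_class: "2 * card {e \<in> Cay_edges G T. Cay_color G T e = t} = q" if "t \<in> T" for t
    using card_involution_edges[of t] Cay_color_class[OF T that] invol[OF that] that assms(2,4,5)
    by auto
  have "even q"
    \<comment> \<open>Any single color class shows that q is even; one exists because
      \<open>T\<close> is nonempty.\<close>
    using color_class assms(6) by (metis dvd_triv_left ex_in_conv)
  moreover have "q > 0"
    using assms(2,4) order_gt_0_iff_finite by simp
  \<comment> \<open>A positive even q is at least 2, so the class size is positive, as the type
    requires.\<close>
  ultimately have "q div 2 \<ge> 1"
    by auto
  moreover have "card {e \<in> Cay_edges G T. Cay_color G T e = t} = q div 2" if "t \<in> T" for t
    using color_class[OF that] by simp
  moreover have "regular_graph (carrier G) (Cay_edges G T) p"
    using regular_graph_Cay[OF T] invol(2) assms(7) by blast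
  moreover have "\<forall>e\<in>Cay_edges G T. \<forall>f\<in>Cay_edges G T.
      e \<noteq> f \<and> e \<inter> f \<noteq> {} \<longrightarrow> Cay_color G T e \<noteq> Cay_color G T f"
    using Cay_color_proper[OF T] by blast
  ultimately show ?thesis
    using \<open>even q\<close> \<open>q > 0\<close> Cay_color_edge[OF T] Cay_color_image[OF T] assms(4,7,8)
    by (simp add: uniform_edge_coloring_def order_def)
qed

end
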